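(* Let $m\ge 1$, let $\omega=(w_1,\ldots,w_m)$ be a probability vector, let $A_1,\ldots,A_m,X_0\in\mathrm{UT}_2$ and $c>0$. Let $D=\operatorname{diag}(A_1^{w_1}\cdots A_m^{w_m})$, write $D^{-1}A_i=\begin{bmatrix} a_{11}^{(i)} & a_{12}^{(i)}\\ 0 & a_{22}^{(i)}\end{bmatrix}$, and let $c_0=\sum_{i=1}^m w_i\, f\bigl(a_{22}^{(i)}/a_{11}^{(i)},1\bigr)$. Write $G=G(\omega;A_1,\ldots,A_m)$ for the Karcher mean, and let $\{X_k\}$ be generated from $X_0$ by $$\log(X_k^{-1}X_{k+1})=\frac1c\sum_{i=1}^m w_i\log(X_k^{-1}A_i),\qquad k\ge 0.$$ Then: (1) If $c>1/2$, the diagonal of $X_k$ converges to $D$, and the diagonal entries of $\log(X_k^{-1}X_{k+1})$ form (in $k$) geometric sequences with ratio $1-1/c$. (2) If $c>c_0/2$, then $X_k\to G$, and the asymptotic convergence rates (to $0$) of both $X_k-G$ and $\log(X_k^{-1}X_{k+1})$ are at most $\max\{|1-1/c|,\,|1-c_0/c|\}$. (3) If $0<c\le 1/2$ and $X_0\ne G$, the sequence $\{X_k\}$ does not converge.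
   Context: $\mathrm{UT}_2$ is the group of $2\times 2$ real upper triangular matrices with positive diagonal entries. A probability vector has nonnegative entries summing to $1$. For $A\in\mathrm{UT}_2$, $\log A$ is the principal logarithm (the unique real upper triangular matrix $L$ with $\exp L=A$), and $A^{p}=\exp(p\log A)$ for $p\in\mathbb{R}$. $\operatorname{diag}(A)$ is the diagonal matrix formed from the diagonal entries of $A$. For $x,y>0$, $f(x,y)=\dfrac{\log x-\log y}{x-y}$ if $x\neq y$, and $f(x,x)=1/x$. The Karcher mean $G(\omega;A_1,\ldots,A_m)$ is the solution $X\in\mathrm{UT}_2$ of $\sum_i w_i\log(X^{-1}A_i)=0$; on $\mathrm{UT}_2$ it exists and is unique for all inputs. The iteration is equivalently $X_{k+1}=X_k\exp\left(\frac1c\sum_i w_i\log(X_k^{-1}A_i)\right)$. A sequence $(z_k)_{k\ge 0}$ is geometric with ratio $r$ if $z_{k+1}=r z_k$ for all $k\ge0$. When a sequence of matrices $\{Y_k\}$ converges to $Y$, its asymptotic convergence rate is $\limsup_{k\to\infty}\|Y_k-Y\|_1^{1/k}$, where $\|\cdot\|_1$ is the matrix $1$-norm. *)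

theory Defs
  imports "HOL-Analysis.Analysis"
begin

text \<open>Entries of a matrix of type \<^typ>\<open>real^2^2\<close> are addressed by the indices 1 and 2 of the type 2.
  There the numeral 2 denotes the same index as 0 (so 2 < 1 in the order of that type);
  hence triangularity is stated through explicit entries and not through the order of the index type.\<close>

definition upper_tri :: "real^2^2 \<Rightarrow> bool" where
  "upper_tri A \<longleftrightarrow> A $ 2 $ 1 = 0"

definition UT2 :: "(real^2^2) set" where
  "UT2 = {A. upper_tri A \<and> A $ 1 $ 1 > 0 \<and> A $ 2 $ 2 > 0}"

text \<open>The product \<open>*\<close> of the type \<^typ>\<open>real^2^2\<close> is componentwise, so that the overloaded power and
  \<^const>\<open>exp\<close> are not available for the matrix product \<open>**\<close>.\<close>

primrec mat_pow :: "real^'n^'n \<Rightarrow> nat \<Rightarrow> real^'n^'n" where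
  "mat_pow A 0 = mat 1"
| "mat_pow A (Suc k) = A ** mat_pow A k"

definition mat_exp :: "real^'n^'n \<Rightarrow> real^'n^'n" where
  "mat_exp A = (\<Sum>k. (1 / fact k) *\<^sub>R mat_pow A k)"

definition ut_log :: "real^2^2 \<Rightarrow> real^2^2" where
  "ut_log A = (THE L. upper_tri L \<and> mat_exp L = A)"

definition ut_powr :: "real^2^2 \<Rightarrow> real \<Rightarrow> real^2^2" where
  "ut_powr A p = mat_exp (p *\<^sub>R ut_log A)"

definition diag_part :: "real^'n^'n \<Rightarrow> real^'n^'n" where
  "diag_part A = (\<chi> i j. if i = j then A $ i $ j else 0)"

definition mat_prod_list :: "(real^'n^'n) list \<Rightarrow> real^'n^'n" where
  "mat_prod_list As = foldr (**) As (mat 1)"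

definition log_quot :: "real \<Rightarrow> real \<Rightarrow> real" where
  "log_quot x y = (if x = y then 1 / x else (ln x - ln y) / (x - y))"

definition karcher_sum :: "nat \<Rightarrow> (nat \<Rightarrow> real) \<Rightarrow> (nat \<Rightarrow> real^2^2) \<Rightarrow> real^2^2 \<Rightarrow> real^2^2" where
  "karcher_sum m w A X = (\<Sum>i=1..m. w i *\<^sub>R ut_log (matrix_inv X ** A i))"

definition karcher_mean :: "nat \<Rightarrow> (nat \<Rightarrow> real) \<Rightarrow> (nat \<Rightarrow> real^2^2) \<Rightarrow> real^2^2" where
  "karcher_mean m w A = (THE X. X \<in> UT2 \<and> karcher_sum m w A X = 0)"

text \<open>The operator norm induced by the vector 1-norm, i.e. the maximal absolute column sum.\<close>

definition mat_norm1 :: "real^'n^'n \<Rightarrow> real" where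
  "mat_norm1 A = Max (range (\<lambda>j. \<Sum>i\<in>UNIV. \<bar>A $ i $ j\<bar>))"

definition asymp_rate :: "(nat \<Rightarrow> real^'n^'n) \<Rightarrow> real^'n^'n \<Rightarrow> ereal" where
  "asymp_rate Y L = limsup (\<lambda>k. ereal (root k (mat_norm1 (Y k - L))))"

definition geometric_seq :: "(nat \<Rightarrow> real) \<Rightarrow> real \<Rightarrow> bool" where
  "geometric_seq z r \<longleftrightarrow> (\<forall>k. z (Suc k) = r * z k)"

end

theory Submission
  imports Defs "HOL-Library.Landau_Symbols" "HOL-Real_Asymp.Real_Asymp"
begin

text \<open>On the diagonal the iteration is linear in the logarithms: with \<open>r = 1 - 1 / c\<close> the logarithmic errors
  of the two diagonal entries are \<open>r ^ k * u\<^sub>0\<close> and \<open>r ^ k * v\<^sub>0\<close>. Hence the off-diagonal error obeys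
  \<open>e (k + 1) = \<Phi> (r ^ k) * e k + \<Psi> (r ^ k)\<close> with \<open>\<Phi>\<close> and \<open>\<Psi>\<close> differentiable at 0, \<open>\<Phi> 0 = 1 - c\<^sub>0 / c\<close> and
  \<open>\<Psi> 0 = 0\<close>, which gives the rate. Convexity of \<open>t / (e\<^sup>t - 1)\<close> yields \<open>c\<^sub>0 \<ge> 1\<close>, so that \<open>c > c\<^sub>0 / 2\<close> forces
  \<open>c > 1 / 2\<close>. For \<open>c \<le> 1 / 2\<close> a convergent sequence must have \<open>u\<^sub>0 = v\<^sub>0 = 0\<close>; then \<open>\<Psi>\<close> vanishes on the orbit,
  \<open>\<Phi> = 1 - c\<^sub>0 / c \<le> - 1\<close>, and the off-diagonal error must be 0 as well.\<close>

subsection \<open>Upper triangular matrices in coordinates\<close>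

definition ut :: "real \<Rightarrow> real \<Rightarrow> real \<Rightarrow> real^2^2" where
  "ut a b d = vector [vector [a, b], vector [0, d]]"

lemma ut_nth [simp]:
  "ut a b d $ 1 $ 1 = a" "ut a b d $ 1 $ 2 = b" "ut a b d $ 2 $ 1 = 0" "ut a b d $ 2 $ 2 = d"
  by (simp_all add: ut_def)

lemma mat2_eq_iff:
  fixes A B :: "real^2^2"
  shows "A = B \<longleftrightarrow> A $ 1 $ 1 = B $ 1 $ 1 \<and> A $ 1 $ 2 = B $ 1 $ 2 \<and>
                   A $ 2 $ 1 = B $ 2 $ 1 \<and> A $ 2 $ 2 = B $ 2 $ 2"
  by (auto simp: vec_eq_iff forall_2)

lemma ut_eq_iff [simp]: "ut a b d = ut a' b' d' \<longleftrightarrow> a = a' \<and> b = b' \<and> d = d'"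
  by (auto simp: mat2_eq_iff)

lemma upper_tri_eq_ut: "upper_tri A \<Longrightarrow> A = ut (A $ 1 $ 1) (A $ 1 $ 2) (A $ 2 $ 2)"
  by (simp add: mat2_eq_iff upper_tri_def)

lemma ut_in_UT2 [simp]: "ut a b d \<in> UT2 \<longleftrightarrow> a > 0 \<and> d > 0"
  by (simp add: UT2_def upper_tri_def)

lemma UT2_cases:
  assumes "A \<in> UT2"
  obtains a b d where "A = ut a b d" "a > 0" "d > 0"
  using assms upper_tri_eq_ut[of A] by (auto simp: UT2_def)

lemma ut_mult: "ut a b d ** ut a' b' d' = ut (a * a') (a * b' + b * d') (d * d')"
  by (simp add: mat2_eq_iff matrix_matrix_mult_def sum_2)

lemma ut_scaleR: "s *\<^sub>R ut a b d = ut (s * a) (s * b) (s * d)"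
  by (simp add: mat2_eq_iff)

lemma ut_sum: "(\<Sum>i\<in>I. ut (a i) (b i) (d i)) = ut (sum a I) (sum b I) (sum d I)"
  by (simp add: mat2_eq_iff)

lemma ut_tendsto:
  assumes "(a \<longlongrightarrow> a') F" "(b \<longlongrightarrow> b') F" "(d \<longlongrightarrow> d') F"
  shows "((\<lambda>k. ut (a k) (b k) (d k)) \<longlongrightarrow> ut a' b' d') F"
proof (intro vec_tendstoI)
  fix i j :: 2
  show "((\<lambda>k. ut (a k) (b k) (d k) $ i $ j) \<longlongrightarrow> ut a' b' d' $ i $ j) F"
    using assms exhaust_2[of i] exhaust_2[of j] by auto
qed

lemma ut_zero: "0 = ut 0 0 0"
  by (simp add: mat2_eq_iff)

lemma ut_mat1: "mat 1 = ut 1 0 1"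
  by (simp add: mat2_eq_iff mat_def)

lemma matrix_inv_ut:
  assumes "a > 0" "d > 0"
  shows "matrix_inv (ut a b d) = ut (1 / a) (- b / (a * d)) (1 / d)"
proof -
  let ?A = "ut a b d" and ?B = "ut (1 / a) (- b / (a * d)) (1 / d)"
  have AB: "?A ** ?B = mat 1" "?B ** ?A = mat 1"
    using assms by (simp_all add: ut_mult ut_mat1 field_simps)
  show ?thesis
    unfolding matrix_inv_def
    \<comment> \<open>\<open>matrix_inv\<close> is a choice, so \<open>?B\<close> must be shown to
      be the only two-sided inverse; this is the usual associativity argument.\<close>
    by (rule some_equality) (use AB in \<open>metis matrix_mul_assoc matrix_mul_lid matrix_mul_rid\<close>)+
qed

lemma matrix_inv_ut_mult:
  assumes "x > 0" "z > 0"
  shows "matrix_inv (ut x y z) ** ut a b d = ut (a / x) (b / x - y * d / (x * z)) (d / z)"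
  using assms by (simp add: matrix_inv_ut ut_mult)

subsection \<open>Exponential and logarithm\<close>

text \<open>The sum in the corner is the divided difference of \<open>t ^ k\<close> at x and z,
  written so that it also covers x = z.\<close>

lemma mat_pow_ut:
  "mat_pow (ut x y z) k = ut (x ^ k) (y * (\<Sum>i<k. x ^ i * z ^ (k - Suc i))) (z ^ k)"
proof (induction k)
  case (Suc k)
  have "(\<Sum>i<Suc k. x ^ i * z ^ (Suc k - Suc i)) = x * (\<Sum>i<k. x ^ i * z ^ (k - Suc i)) + z ^ k"
    \<comment> \<open>Splitting off i = 0 gives the summand \<open>z ^ k\<close> and leaves a factor
      x in every other summand.\<close>
    by (subst sum.lessThan_Suc_shift) (simp add: sum_distrib_left mult_ac)
  then show ?case
    unfolding mat_pow.simps Suc ut_mult by (simp add: algebra_simps del: sum.lessThan_Suc)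
qed (simp add: ut_mat1)

lemma log_quot_pos:
  assumes "a > 0" "d > 0"
  shows "log_quot a d > 0"
  using assms by (auto simp: log_quot_def zero_less_divide_iff)

text \<open>The series adds up the divided differences of the monomials, hence gives the divided
  difference of the exponential at x and z; this is the reciprocal of \<open>log_quot\<close> at the
  exponentials.\<close>

lemma off_diagonal_exp_sums:
  "(\<lambda>k. (1 / fact k) * (\<Sum>i<k. x ^ i * z ^ (k - Suc i))) sums (1 / log_quot (exp x) (exp z))"
proof (cases "x = z")
  case True
  have "(\<lambda>k. (1 / fact (Suc k)) * (\<Sum>i<Suc k. x ^ i * z ^ (Suc k - Suc i))) = (\<lambda>k. x ^ k /\<^sub>R fact k)"
  proof
    fix k
    have "(\<Sum>i<Suc k. x ^ i * z ^ (Suc k - Suc i)) = (\<Sum>i<Suc k. x ^ k)"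
      using True by (intro sum.cong refl) (simp flip: power_add)
    then show "(1 / fact (Suc k)) * (\<Sum>i<Suc k. x ^ i * z ^ (Suc k - Suc i)) = x ^ k /\<^sub>R fact k"
      by (simp add: divide_simps del: of_nat_Suc sum.lessThan_Suc)
  qed
  then have "(\<lambda>k. (1 / fact (Suc k)) * (\<Sum>i<Suc k. x ^ i * z ^ (Suc k - Suc i))) sums exp x"
    using exp_converges[of x] by simp
  \<comment> \<open>The index moves back by one without a correction, since the summand at k = 0 is
    an empty sum.\<close>
  then have "(\<lambda>k. (1 / fact k) * (\<Sum>i<k. x ^ i * z ^ (k - Suc i))) sums exp x"
    by (subst (asm) sums_Suc_iff) simp
  then show ?thesis using True by (simp add: log_quot_def)
next
  case False
  have "(\<Sum>i<k. x ^ i * z ^ (k - Suc i)) = (x ^ k - z ^ k) / (x - z)" for k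
    using False power_diff_sumr2[of x k z] by (simp add: mult.commute[of "z ^ _"])
  then have "(\<lambda>k. (1 / fact k) * (\<Sum>i<k. x ^ i * z ^ (k - Suc i))) =
        (\<lambda>k. (x ^ k /\<^sub>R fact k - z ^ k /\<^sub>R fact k) / (x - z))"
    using False by (simp add: fun_eq_iff divide_simps)
  moreover have "\<dots> sums ((exp x - exp z) / (x - z))"
    by (intro sums_divide sums_diff exp_converges)
  ultimately show ?thesis using False by (simp add: log_quot_def)
qed

lemma mat_exp_ut: "mat_exp (ut x y z) = ut (exp x) (y / log_quot (exp x) (exp z)) (exp z)"
proof -
  have off: "(\<lambda>k. (1 / fact k) * (y * (\<Sum>i<k. x ^ i * z ^ (k - Suc i)))) sums
      (y / log_quot (exp x) (exp z))"
    using sums_mult[OF off_diagonal_exp_sums, of y x z] by (simp add: mult_ac)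
  have diag: "(\<lambda>k. (1 / fact k) * t ^ k) sums exp t" for t :: real
    using exp_converges[of t] by (simp add: divide_inverse)
  have "(\<lambda>k. (1 / fact k) *\<^sub>R mat_pow (ut x y z) k) sums
      ut (exp x) (y / log_quot (exp x) (exp z)) (exp z)"
    unfolding mat_pow_ut ut_scaleR sums_def ut_sum
    using off diag[of x] diag[of z] unfolding sums_def by (intro ut_tendsto) auto
  then show ?thesis
    by (simp add: mat_exp_def sums_iff)
qed

text \<open>\<open>mat_exp\<close> is injective on upper triangular matrices: the diagonal of the
  image determines x and z, and y is then only scaled by a positive factor. So the definite
  description denotes.\<close>

lemma ut_log_ut:
  assumes "a > 0" "d > 0"
  shows "ut_log (ut a b d) = ut (ln a) (b * log_quot a d) (ln d)"
  unfolding ut_log_def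
proof (rule the_equality)
  show "upper_tri (ut (ln a) (b * log_quot a d) (ln d)) \<and>
      mat_exp (ut (ln a) (b * log_quot a d) (ln d)) = ut a b d"
    using assms log_quot_pos[OF assms] by (simp add: mat_exp_ut upper_tri_def)
next
  fix L assume L: "upper_tri L \<and> mat_exp L = ut a b d"
  then obtain x y z where L_eq: "L = ut x y z"
    using upper_tri_eq_ut by blast
  with L have "ut (exp x) (y / log_quot (exp x) (exp z)) (exp z) = ut a b d"
    using mat_exp_ut by metis
  then have "exp x = a" "exp z = d" "y / log_quot (exp x) (exp z) = b"
    unfolding ut_eq_iff by blast+
  moreover from this have "y = b * log_quot a d"
    using log_quot_pos[OF assms] by (auto simp: field_simps)
  ultimately show "L = ut (ln a) (b * log_quot a d) (ln d)"
    using L_eq by auto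
qed

lemma ut_powr_ut:
  assumes "a > 0" "d > 0"
  obtains b' where "ut_powr (ut a b d) p = ut (a powr p) b' (d powr p)"
  using assms by (simp add: ut_powr_def ut_log_ut ut_scaleR mat_exp_ut powr_def)

text \<open>Taking diagonals is multiplicative on upper triangular matrices. The corner entry is
  left existential because \<open>diag_part\<close> discards it.\<close>

lemma diag_mat_prod_list_powr:
  assumes "\<And>i. i \<in> set is \<Longrightarrow> A i \<in> UT2"
  shows "\<exists>b. mat_prod_list (map (\<lambda>i. ut_powr (A i) (w i)) is) =
    ut (exp (\<Sum>i\<leftarrow>is. w i * ln (A i $ 1 $ 1))) b (exp (\<Sum>i\<leftarrow>is. w i * ln (A i $ 2 $ 2)))"
  using assms
proof (induction "is")
  case Nil
  then show ?case by (auto simp: mat_prod_list_def ut_mat1)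
next
  case (Cons i "is")
  obtain b where b: "mat_prod_list (map (\<lambda>i. ut_powr (A i) (w i)) is) =
    ut (exp (\<Sum>i\<leftarrow>is. w i * ln (A i $ 1 $ 1))) b (exp (\<Sum>i\<leftarrow>is. w i * ln (A i $ 2 $ 2)))"
    using Cons by auto
  obtain p q s where A: "A i = ut p q s" "p > 0" "s > 0"
    using Cons.prems UT2_cases by (metis list.set_intros(1))
  obtain b' where b': "ut_powr (ut p q s) (w i) = ut (p powr w i) b' (s powr w i)"
    using ut_powr_ut A by blast
  have "mat_prod_list (map (\<lambda>i. ut_powr (A i) (w i)) (i # is)) =
      ut_powr (ut p q s) (w i) ** mat_prod_list (map (\<lambda>i. ut_powr (A i) (w i)) is)"
    using A by (simp add: mat_prod_list_def)
  then show ?case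
    using A unfolding b b' ut_mult by (intro exI[of _ "p powr w i * b + b' * exp (\<Sum>i\<leftarrow>is. w i * ln (A i $ 2 $ 2))"])
      (simp add: exp_add powr_def mult_ac)
qed

lemma diag_part_ut: "diag_part (ut a b d) = ut a 0 d"
  by (simp add: mat2_eq_iff diag_part_def)

subsection \<open>The function \<open>t / (e\<^sup>t - 1)\<close>\<close>

text \<open>The generating function of the Bernoulli numbers, with the removable singularity at 0
  filled in.\<close>

definition bern :: "real \<Rightarrow> real" where
  "bern t = (if t = 0 then 1 else t / (exp t - 1))"

lemma bern_0 [simp]: "bern 0 = 1"
  by (simp add: bern_def)

lemma bern_pos: "bern t > 0"
  by (auto simp: bern_def zero_less_divide_iff)

lemma bern_minus: "bern (- t) = bern t + t"
proof (cases "t = 0")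
  case False
  then have "exp t \<noteq> 1" by simp
  then show ?thesis using False
    by (simp add: bern_def exp_minus field_simps)
qed simp

text \<open>Up to the factor \<open>1 / d\<close>, the logarithmic quotient depends only on the
  difference of the logarithms, which the iteration changes linearly.\<close>

lemma log_quot_eq_bern:
  assumes "a > 0" "d > 0"
  shows "log_quot a d = bern (ln a - ln d) / d"
  using assms by (auto simp: log_quot_def bern_def exp_diff field_simps)

text \<open>The bound is the tangent at 0 of the convex function \<^const>\<open>bern\<close>.\<close>

lemma bern_ge: "bern t \<ge> 1 - t / 2"
proof -
  \<comment> \<open>\<open>g t\<close> is the claimed difference multiplied by
    \<open>exp t - 1\<close>, a factor with the sign of t. As g increases through 0 at t = 0, both
    signs of t are settled.\<close>
  define g where "g t = t - (1 - t / 2) * (exp t - 1)" for t :: real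
  have deriv: "(g has_real_derivative (1 - exp t * (1 - t)) / 2) (at t)" for t
    unfolding g_def by (auto intro!: derivative_eq_intros simp: field_simps)
  have "exp t * (1 - t) \<le> 1" for t :: real
    using exp_ge_add_one_self[of "- t"] by (simp add: exp_minus field_simps)
  then have mono: "g s \<le> g t" if "s \<le> t" for s t
    using DERIV_nonneg_imp_nondecreasing[OF that, of g] deriv by force
  have g0: "g 0 = 0" by (simp add: g_def)
  consider "t = 0" | "t > 0" | "t < 0" by linarith
  then show ?thesis
  proof cases
    case 2
    then have "g t \<ge> 0" using mono[of 0 t] g0 by simp
    with 2 show ?thesis by (simp add: bern_def g_def field_simps)
  next
    case 3
    then have "g t \<le> 0" using mono[of t 0] g0 by simp
    with 3 show ?thesis by (simp add: bern_def g_def field_simps)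
  qed simp
qed

text \<open>Later only the existence of the derivative matters; writing it as
  \<open>deriv bern t\<close> yields one rule for all t that can be chained.\<close>

lemma bern_has_deriv: "(bern has_real_derivative deriv bern t) (at t)"
proof (cases "t = 0")
  case True
  \<comment> \<open>This is the difference quotient at the removable singularity.\<close>
  have "((\<lambda>h::real. (h / (exp h - 1) - 1) / h) \<longlongrightarrow> - 1 / 2) (at 0)"
    by real_asymp
  then have "((\<lambda>h. (bern (0 + h) - bern 0) / h) \<longlongrightarrow> - 1 / 2) (at 0)"
    by (rule Lim_transform_eventually) (auto simp: eventually_at_filter bern_def)
  then show ?thesis
    using True by (auto simp: DERIV_def DERIV_imp_deriv)
next
  case False
  have "((\<lambda>t. t / (exp t - 1)) has_real_derivative (exp t - 1 - t * exp t) / (exp t - 1)\<^sup>2) (at t)"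
    using False by (auto intro!: derivative_eq_intros simp: power2_eq_square)
  then have "(bern has_real_derivative (exp t - 1 - t * exp t) / (exp t - 1)\<^sup>2) (at t)"
    by (rule has_field_derivative_transform_within_open[where S = "- {0}"])
       (use False in \<open>auto simp: bern_def\<close>)
  then show ?thesis
    by (simp add: DERIV_imp_deriv)
qed

lemmas bern_deriv [derivative_intros] = DERIV_chain2[OF bern_has_deriv]

subsection \<open>Geometric decay and asymptotic rates\<close>

text \<open>From some index on the multiplier is below a number smaller than \<rho>, and the
  remaining gap absorbs the forcing term; a bound \<open>C * \<rho> ^ k\<close> then propagates by
  induction.\<close>

lemma perturbed_linear_recursion_bigo:
  fixes e p q :: "nat \<Rightarrow> real"
  assumes rec: "\<And>k. e (Suc k) = p k * e k + q k"
    and p: "p \<longlonglongrightarrow> \<alpha>" and \<rho>: "\<bar>\<alpha>\<bar> < \<rho>" and q: "q \<in> O(\<lambda>k. \<rho> ^ k)"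
  shows "e \<in> O(\<lambda>k. \<rho> ^ k)"
proof -
  define \<rho>' where "\<rho>' = (\<bar>\<alpha>\<bar> + \<rho>) / 2"
  have \<rho>': "\<bar>\<alpha>\<bar> < \<rho>'" "\<rho>' < \<rho>" "\<rho>' > 0" using \<rho> by (auto simp: \<rho>'_def)
  have "eventually (\<lambda>k. \<bar>p k\<bar> < \<rho>') sequentially"
    using tendsto_rabs[OF p] \<rho>'(1) by (rule order_tendstoD)
  moreover obtain K where "K > 0" "eventually (\<lambda>k. norm (q k) \<le> K * norm (\<rho> ^ k)) sequentially"
    using q by (rule landau_o.bigE)
  ultimately have "eventually (\<lambda>k. \<bar>p k\<bar> < \<rho>' \<and> norm (q k) \<le> K * norm (\<rho> ^ k)) sequentially"
    by (intro eventually_conj)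
  then obtain N where N: "\<And>k. k \<ge> N \<Longrightarrow> \<bar>p k\<bar> \<le> \<rho>'" "\<And>k. k \<ge> N \<Longrightarrow> \<bar>q k\<bar> \<le> K * \<rho> ^ k"
    using \<rho>' by (force simp: eventually_sequentially)
  \<comment> \<open>The first argument of the maximum starts the induction at N, the second makes
    \<open>\<rho>' * C + K \<le> C * \<rho>\<close>, which is the induction step.\<close>
  define C where "C = max (\<bar>e N\<bar> / \<rho> ^ N) (K / (\<rho> - \<rho>'))"
  have "K / (\<rho> - \<rho>') \<le> C" by (simp add: C_def)
  then have CK: "\<rho>' * C + K \<le> C * \<rho>" using \<rho>' by (simp add: field_simps)
  have "\<bar>e N\<bar> / \<rho> ^ N \<le> C" by (simp add: C_def)
  then have CN: "\<bar>e N\<bar> \<le> C * \<rho> ^ N" using \<rho>' by (simp add: field_simps)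
  have "\<bar>e k\<bar> \<le> C * \<rho> ^ k" if "k \<ge> N" for k
    using that
  proof (induction k rule: dec_induct)
    case base
    show ?case by (rule CN)
  next
    case (step k)
    have "\<bar>e (Suc k)\<bar> \<le> \<bar>p k\<bar> * \<bar>e k\<bar> + \<bar>q k\<bar>"
      unfolding rec by (metis abs_mult abs_triangle_ineq)
    also have "\<dots> \<le> \<rho>' * (C * \<rho> ^ k) + K * \<rho> ^ k"
      using N step \<rho>' by (intro add_mono mult_mono) auto
    also have "\<dots> = (\<rho>' * C + K) * \<rho> ^ k" by (simp add: algebra_simps)
    also have "\<dots> \<le> (C * \<rho>) * \<rho> ^ k"
      using CK \<rho>' by (intro mult_right_mono) auto
    finally show ?case by (simp add: algebra_simps)
  qed
  then show ?thesis
    using \<rho>' by (intro bigoI[of _ C]) (auto simp: eventually_sequentially)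
qed

text \<open>By Caratheodory's form of differentiability \<open>f h = g h * h\<close> with g
  continuous at 0, so \<open>g (r ^ k)\<close> stays bounded and the factor \<open>r ^ k\<close>
  gives the decay.\<close>

lemma differentiable_at_power_bigo:
  fixes f :: "real \<Rightarrow> real"
  assumes f: "(f has_real_derivative f') (at 0)" and f0: "f 0 = 0"
    and r: "\<bar>r\<bar> < 1" "\<bar>r\<bar> \<le> \<rho>"
  shows "(\<lambda>k. f (r ^ k)) \<in> O(\<lambda>k. \<rho> ^ k)"
proof -
  obtain g where g: "\<And>z. f z - f 0 = g z * (z - 0)" "isCont g 0"
    using f unfolding CARAT_DERIV by blast
  have "(\<lambda>k. g (r ^ k)) \<longlonglongrightarrow> g 0"
    using r g(2) by (intro isCont_tendsto_compose[where g = g] LIMSEQ_abs_realpow_zero2) auto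
  then have "(\<lambda>k. g (r ^ k)) \<in> O(\<lambda>_. 1)"
    by (intro bigoI_tendsto[where c = "g 0"]) auto
  moreover have "(\<lambda>k. r ^ k) \<in> O(\<lambda>k. \<rho> ^ k)"
    using r by (intro bigoI[of _ 1]) (auto simp: power_abs intro!: power_mono always_eventually)
  ultimately have "(\<lambda>k. g (r ^ k) * r ^ k) \<in> O(\<lambda>k. 1 * \<rho> ^ k)"
    by (rule landau_o.big.mult)
  then show ?thesis using g(1) f0 by simp
qed

lemma bigo_power_tendsto_0:
  fixes f :: "nat \<Rightarrow> real"
  assumes "f \<in> O(\<lambda>k. \<rho> ^ k)" "\<bar>\<rho>\<bar> < 1"
  shows "f \<longlonglongrightarrow> 0"
proof -
  obtain C where C: "eventually (\<lambda>k. norm (f k) \<le> C * norm (\<rho> ^ k)) sequentially"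
    using assms(1) by (auto elim: landau_o.bigE)
  have "(\<lambda>k. C * norm (\<rho> ^ k)) \<longlonglongrightarrow> C * norm (0 :: real)"
    using assms(2) by (intro tendsto_intros LIMSEQ_abs_realpow_zero2) auto
  then show ?thesis using C by (auto intro: Lim_null_comparison)
qed

text \<open>The k-th root of the constant in the bound tends to 1, so the rate is at most every
  \<rho> > r, hence at most r. Bounds are asked only for \<rho> > r because a resonance such as
  \<open>k * r ^ k\<close> is not bounded by a multiple of \<open>r ^ k\<close>.\<close>

lemma asymp_rate_le:
  fixes Y :: "nat \<Rightarrow> real^2^2"
  assumes Y: "\<And>\<rho> i j. \<rho> > r \<Longrightarrow> (\<lambda>k. Y k $ i $ j) \<in> O(\<lambda>k. \<rho> ^ k)" and "r \<ge> 0"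
  shows "asymp_rate Y 0 \<le> ereal r"
proof (rule ereal_le_epsilon2)
  fix \<epsilon> :: real assume \<epsilon>: "\<epsilon> > 0"
  define \<rho> where "\<rho> = r + \<epsilon>"
  have \<rho>: "\<rho> > 0" "\<rho> > r" using \<epsilon> \<open>r \<ge> 0\<close> by (auto simp: \<rho>_def)
  have "(\<lambda>k. mat_norm1 (Y k)) \<in> O(\<lambda>k. \<rho> ^ k)"
  proof -
    have entries: "(\<lambda>k. \<Sum>j\<in>UNIV. \<Sum>i\<in>UNIV. \<bar>Y k $ i $ j\<bar>) \<in> O(\<lambda>k. \<rho> ^ k)"
      using Y[OF \<rho>(2)] by (intro big_sum_in_bigo) (auto simp: landau_o.big.abs_in_iff)
    have norm_le: "norm (mat_norm1 (Y k)) \<le> 1 * norm (\<Sum>j\<in>UNIV. \<Sum>i\<in>UNIV. \<bar>Y k $ i $ j\<bar>)" for k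
    proof -
      have "mat_norm1 (Y k) \<le> (\<Sum>j\<in>UNIV. \<Sum>i\<in>UNIV. \<bar>Y k $ i $ j\<bar>)"
        unfolding mat_norm1_def by (subst Max_le_iff) (auto intro!: member_le_sum sum_nonneg)
      moreover have "0 \<le> mat_norm1 (Y k)"
        unfolding mat_norm1_def by (subst Max_ge_iff) (auto intro!: exI sum_nonneg)
      ultimately show ?thesis by simp
    qed
    from norm_le have "(\<lambda>k. mat_norm1 (Y k)) \<in> O(\<lambda>k. \<Sum>j\<in>UNIV. \<Sum>i\<in>UNIV. \<bar>Y k $ i $ j\<bar>)"
      by (intro bigoI[of _ 1] always_eventually allI)
    then show ?thesis using entries by (rule landau_o.big_trans)
  qed
  then obtain C where "C > 0" and C: "eventually (\<lambda>k. norm (mat_norm1 (Y k)) \<le> C * norm (\<rho> ^ k)) sequentially"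
    by (rule landau_o.bigE)
  have "(\<lambda>k. ereal (root k C * \<rho>)) \<longlonglongrightarrow> ereal (1 * \<rho>)"
    using \<open>C > 0\<close> by (intro tendsto_intros LIMSEQ_root_const)
  then have lim: "limsup (\<lambda>k. ereal (root k C * \<rho>)) = ereal \<rho>"
    by (simp add: lim_imp_Limsup)
  have "eventually (\<lambda>k. ereal (root k (mat_norm1 (Y k - 0))) \<le> ereal (root k C * \<rho>)) sequentially"
    \<comment> \<open>The index 0 is excluded: \<open>root 0\<close> is constantly 0 and does not
      cancel the power.\<close>
    using C eventually_gt_at_top[of 0]
  proof eventually_elim
    case (elim k)
    then have "mat_norm1 (Y k) \<le> C * \<rho> ^ k" using \<rho> by (simp add: abs_le_iff)
    then have "root k (mat_norm1 (Y k)) \<le> root k (C * \<rho> ^ k)"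
      using elim by simp
    also have "\<dots> = root k C * \<rho>"
      using elim \<rho> by (simp add: real_root_mult real_root_power_cancel)
    finally show ?case by simp
  qed
  then have "asymp_rate Y 0 \<le> limsup (\<lambda>k. ereal (root k C * \<rho>))"
    unfolding asymp_rate_def by (rule Limsup_mono)
  then show "asymp_rate Y 0 \<le> ereal r + ereal \<epsilon>"
    unfolding lim by (simp add: \<rho>_def)
qed

lemma matrix_bigo_power_tendsto_0:
  fixes Y :: "nat \<Rightarrow> real^'n^'m"
  assumes "\<And>i j. (\<lambda>k. Y k $ i $ j) \<in> O(\<lambda>k. \<rho> ^ k)" "\<bar>\<rho>\<bar> < 1"
  shows "Y \<longlonglongrightarrow> 0"
  using assms bigo_power_tendsto_0 by (intro vec_tendstoI) auto

section \<open>Criteria for divergence\<close>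

text \<open>The powers of r are at least 1 at even and at most -1 at odd indices, so for nonzero u
  the two subsequences stay on different sides of 1 and cannot share a limit.\<close>

lemma exp_power_not_convergent:
  fixes r u :: real
  assumes "convergent (\<lambda>k. exp (r ^ k * u))" "r \<le> - 1"
  shows "u = 0"
proof (rule ccontr)
  assume "u \<noteq> 0"
  obtain l where l: "(\<lambda>k. exp (r ^ k * u)) \<longlonglongrightarrow> l"
    using assms(1) by (auto simp: convergent_def)
  have r1: "(- r) ^ k \<ge> 1" for k
    using assms(2) by (intro one_le_power) simp
  have even: "r ^ (2 * k) \<ge> 1" and odd: "r ^ Suc (2 * k) \<le> - 1" for k
    using r1[of "2 * k"] r1[of "Suc (2 * k)"] by (simp_all add: power_minus_even power_minus_odd del: power_Suc)
  have lim_even: "(\<lambda>k. exp (r ^ (2 * k) * u)) \<longlonglongrightarrow> l"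
    by (rule LIMSEQ_subseq_LIMSEQ[OF l, of "\<lambda>k. 2 * k", unfolded o_def]) (simp add: strict_mono_def)
  have lim_odd: "(\<lambda>k. exp (r ^ Suc (2 * k) * u)) \<longlonglongrightarrow> l"
    by (rule LIMSEQ_subseq_LIMSEQ[OF l, of "\<lambda>k. Suc (2 * k)", unfolded o_def]) (simp add: strict_mono_def)
  show False
  proof (cases "u > 0")
    case True
    have "exp u \<le> l"
      by (rule LIMSEQ_le_const[OF lim_even]) (use even True in \<open>auto simp: mult_le_cancel_right1\<close>)
    moreover have "l \<le> exp (- u)"
      by (rule LIMSEQ_le_const2[OF lim_odd])
         (use mult_right_mono[OF odd, of u] True in \<open>auto simp del: power_Suc\<close>)
    ultimately have "exp u \<le> exp (- u)" by linarith
    then show False using True by simp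
  next
    case False
    have "l \<le> exp u"
      by (rule LIMSEQ_le_const2[OF lim_even])
         (use mult_right_mono_neg[OF even, of u] False in \<open>auto simp del: power_Suc\<close>)
    moreover have "exp (- u) \<le> l"
      by (rule LIMSEQ_le_const[OF lim_odd])
         (use mult_right_mono_neg[OF odd, of u] False in \<open>auto simp del: power_Suc\<close>)
    ultimately have "exp (- u) \<le> exp u" by linarith
    then show False using False \<open>u \<noteq> 0\<close> by simp
  qed
qed

text \<open>Consecutive terms differ by \<open>(1 - \<alpha>) * \<bar>e k\<bar>\<close> in absolute
  value, which is at least \<open>2 * \<bar>e 0\<bar>\<close>, whereas convergence sends these
  differences to 0.\<close>

lemma linear_recursion_not_convergent:
  fixes e :: "nat \<Rightarrow> real"
  assumes rec: "\<And>k. e (Suc k) = \<alpha> * e k" and "\<alpha> \<le> - 1" and conv: "convergent e"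
  shows "e 0 = 0"
proof -
  have diff: "\<bar>e (Suc k) - e k\<bar> \<ge> 2 * \<bar>e 0\<bar>" for k
  proof -
    have "e k = \<alpha> ^ k * e 0"
      by (induction k) (simp_all add: rec)
    then have "\<bar>e k\<bar> = \<bar>\<alpha>\<bar> ^ k * \<bar>e 0\<bar>"
      by (simp add: abs_mult power_abs)
    then have "\<bar>e 0\<bar> \<le> \<bar>e k\<bar>"
      using \<open>\<alpha> \<le> - 1\<close> mult_right_mono[OF one_le_power[of "\<bar>\<alpha>\<bar>" k], of "\<bar>e 0\<bar>"] by simp
    then have "2 * \<bar>e 0\<bar> \<le> (1 - \<alpha>) * \<bar>e k\<bar>"
      using \<open>\<alpha> \<le> - 1\<close> by (intro mult_mono) auto
    also have "\<dots> = \<bar>(\<alpha> - 1) * e k\<bar>"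
      using \<open>\<alpha> \<le> - 1\<close> by (simp add: abs_mult)
    finally show ?thesis by (simp add: rec algebra_simps)
  qed
  obtain l where l: "e \<longlonglongrightarrow> l" using conv by (auto simp: convergent_def)
  have "(\<lambda>k. \<bar>e (Suc k) - e k\<bar>) \<longlonglongrightarrow> \<bar>l - l\<bar>"
    by (intro tendsto_intros LIMSEQ_Suc l)
  then have "2 * \<bar>e 0\<bar> \<le> \<bar>l - l\<bar>"
    by (rule LIMSEQ_le_const) (use diff in auto)
  then show ?thesis by simp
qed

subsection \<open>The Karcher mean\<close>

locale weighted_UT2 =
  fixes m :: nat and w :: "nat \<Rightarrow> real" and A :: "nat \<Rightarrow> real^2^2"
  assumes w_nonneg: "\<And>i. i \<in> {1..m} \<Longrightarrow> w i \<ge> 0" and w_sum: "(\<Sum>i=1..m. w i) = 1"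
    and A_UT2: "\<And>i. i \<in> {1..m} \<Longrightarrow> A i \<in> UT2"
begin

text \<open>The weighted geometric means of the diagonal entries, which are the diagonal of D and of
  the Karcher mean.\<close>

definition \<delta>\<^sub>1 :: real where "\<delta>\<^sub>1 = exp (\<Sum>i=1..m. w i * ln (A i $ 1 $ 1))"
definition \<delta>\<^sub>2 :: real where "\<delta>\<^sub>2 = exp (\<Sum>i=1..m. w i * ln (A i $ 2 $ 2))"

text \<open>The logarithm of the ratio of the two diagonal entries of
  \<open>matrix_inv D ** A i\<close>.\<close>

definition \<tau> :: "nat \<Rightarrow> real" where
  "\<tau> i = (ln (A i $ 1 $ 1) - ln \<delta>\<^sub>1) - (ln (A i $ 2 $ 2) - ln \<delta>\<^sub>2)"

text \<open>At \<open>X = ut x y z\<close> with \<open>t = ln (x / \<delta>\<^sub>1) - ln (z / \<delta>\<^sub>2)\<close> the off-diagonal entry of the Karcher sum is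
  \<open>(z * P t - y * Q t) / x\<close>.\<close>

definition P :: "real \<Rightarrow> real" where
  "P t = (\<Sum>i=1..m. w i * (A i $ 1 $ 2 / A i $ 2 $ 2) * bern (\<tau> i - t))"
definition Q :: "real \<Rightarrow> real" where
  "Q t = (\<Sum>i=1..m. w i * bern (\<tau> i - t))"

text \<open>The zero in y of the off-diagonal entry of the Karcher sum once the diagonal of X is
  that of D, so that t = 0.\<close>

definition y\<^sub>G :: real where "y\<^sub>G = \<delta>\<^sub>2 * P 0 / Q 0"

lemma \<delta>_pos [simp]: "\<delta>\<^sub>1 > 0" "\<delta>\<^sub>2 > 0"
  by (simp_all add: \<delta>\<^sub>1_def \<delta>\<^sub>2_def)

lemma \<delta>_nonzero [simp]: "\<delta>\<^sub>1 \<noteq> 0" "\<delta>\<^sub>2 \<noteq> 0"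
  using \<delta>_pos less_irrefl by metis+

lemma A_pos: "i \<in> {1..m} \<Longrightarrow> A i $ 1 $ 1 > 0" "i \<in> {1..m} \<Longrightarrow> A i $ 2 $ 2 > 0"
  using A_UT2 by (auto simp: UT2_def)

lemma A_eq_ut: "i \<in> {1..m} \<Longrightarrow> A i = ut (A i $ 1 $ 1) (A i $ 1 $ 2) (A i $ 2 $ 2)"
  using A_UT2 upper_tri_eq_ut by (auto simp: UT2_def)

lemma sum_w_const: "(\<Sum>i=1..m. w i * s) = s"
  unfolding sum_distrib_right[symmetric] w_sum by simp

lemma sum_w_\<tau>: "(\<Sum>i=1..m. w i * \<tau> i) = 0"
  unfolding \<tau>_def right_diff_distrib sum_subtractf sum_w_const by (simp add: \<delta>\<^sub>1_def \<delta>\<^sub>2_def)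

text \<open>Jensen's inequality for \<open>bern\<close> at the weighted mean 0 of the
  \<open>\<tau> i\<close>: in the sum of the tangent bounds the linear terms cancel.\<close>

lemma Q_0_ge: "Q 0 \<ge> 1"
proof -
  have "1 = (\<Sum>i=1..m. w i) - (\<Sum>i=1..m. w i * \<tau> i) / 2"
    unfolding w_sum sum_w_\<tau> by simp
  also have "\<dots> = (\<Sum>i=1..m. w i * (1 - \<tau> i / 2))"
    by (simp add: right_diff_distrib sum_subtractf sum_divide_distrib)
  also have "\<dots> \<le> Q 0"
    unfolding Q_def using w_nonneg bern_ge by (intro sum_mono mult_left_mono) auto
  finally show ?thesis .
qed

text \<open>This identifies \<open>Q 0\<close> with \<open>c\<^sub>0\<close>: each quotient is
  \<open>bern (- \<tau> i) = bern (\<tau> i) + \<tau> i\<close>, and the weighted sum of the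
  \<open>\<tau> i\<close> vanishes.\<close>

lemma Q_0_eq_log_quot:
  "Q 0 = (\<Sum>i=1..m. w i * log_quot ((A i $ 2 $ 2 / \<delta>\<^sub>2) / (A i $ 1 $ 1 / \<delta>\<^sub>1)) 1)"
proof -
  have "w i * log_quot ((A i $ 2 $ 2 / \<delta>\<^sub>2) / (A i $ 1 $ 1 / \<delta>\<^sub>1)) 1 = w i * bern (\<tau> i) + w i * \<tau> i"
    if "i \<in> {1..m}" for i
  proof -
    have "ln ((A i $ 2 $ 2 / \<delta>\<^sub>2) / (A i $ 1 $ 1 / \<delta>\<^sub>1)) = - \<tau> i"
      using A_pos[OF that] by (simp add: \<tau>_def ln_div ln_mult)
    then show ?thesis
      using A_pos[OF that] by (simp add: log_quot_eq_bern bern_minus algebra_simps)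
  qed
  then show ?thesis
    using sum_w_\<tau> by (simp add: Q_def sum.distrib del: One_nat_def)
qed

text \<open>For a fixed diagonal of X, the corner of each logarithm is affine in y, and
  \<open>bern\<close> enters only through \<open>\<tau> i - t\<close>. This is what makes the
  off-diagonal recursion linear.\<close>

lemma karcher_sum_ut:
  assumes "x > 0" "z > 0" and t: "t = (ln x - ln \<delta>\<^sub>1) - (ln z - ln \<delta>\<^sub>2)"
  shows "karcher_sum m w A (ut x y z) =
    ut (ln \<delta>\<^sub>1 - ln x) ((z * P t - y * Q t) / x) (ln \<delta>\<^sub>2 - ln z)"
proof -
  have "w i *\<^sub>R ut_log (matrix_inv (ut x y z) ** A i) =
      ut (w i * (ln (A i $ 1 $ 1) - ln x))
        (z / x * (w i * (A i $ 1 $ 2 / A i $ 2 $ 2) * bern (\<tau> i - t)) - y / x * (w i * bern (\<tau> i - t)))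
        (w i * (ln (A i $ 2 $ 2) - ln z))" (is "_ = ut (?d1 i) (?o i) (?d2 i)")
    if i: "i \<in> {1..m}" for i
  proof -
    obtain a b d where A: "A i = ut a b d" and ad: "a > 0" "d > 0"
      using UT2_cases A_UT2[OF i] by blast
    have "ln (a / x) - ln (d / z) = \<tau> i - t"
      using ad assms by (simp add: ln_div \<tau>_def A)
    then have "log_quot (a / x) (d / z) = bern (\<tau> i - t) / (d / z)"
      using ad assms(1,2) by (subst log_quot_eq_bern) simp_all
    then have "ut_log (matrix_inv (ut x y z) ** A i) =
        ut (ln (a / x)) ((b / x - y * d / (x * z)) * (bern (\<tau> i - t) / (d / z))) (ln (d / z))"
      using ad assms(1,2) by (simp add: A matrix_inv_ut_mult ut_log_ut)
    moreover have "(b / x - y * d / (x * z)) * (bern (\<tau> i - t) / (d / z)) =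
        z / x * ((b / d) * bern (\<tau> i - t)) - y / x * bern (\<tau> i - t)"
      using ad assms(1,2) by (simp add: field_simps)
    ultimately show ?thesis
      using ad assms(1,2) by (simp add: A ut_scaleR ln_div right_diff_distrib mult_ac)
  qed
  then have "karcher_sum m w A (ut x y z) = (\<Sum>i=1..m. ut (?d1 i) (?o i) (?d2 i))"
    unfolding karcher_sum_def by (intro sum.cong) auto
  also have "\<dots> = ut (\<Sum>i=1..m. ?d1 i) (\<Sum>i=1..m. ?o i) (\<Sum>i=1..m. ?d2 i)"
    by (rule ut_sum)
  also have "(\<Sum>i=1..m. ?o i) = z / x * P t - y / x * Q t"
    by (simp add: P_def Q_def sum_subtractf sum_distrib_left)
  also have "\<dots> = (z * P t - y * Q t) / x"
    by (simp add: diff_divide_distrib)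
  also have "(\<Sum>i=1..m. ?d1 i) = ln \<delta>\<^sub>1 - ln x"
    unfolding right_diff_distrib sum_subtractf sum_w_const by (simp add: \<delta>\<^sub>1_def)
  also have "(\<Sum>i=1..m. ?d2 i) = ln \<delta>\<^sub>2 - ln z"
    unfolding right_diff_distrib sum_subtractf sum_w_const by (simp add: \<delta>\<^sub>2_def)
  finally show ?thesis .
qed

text \<open>The diagonal of the Karcher equation forces x, z and hence t = 0; the corner is then a
  linear equation in y with coefficient \<open>Q 0 \<ge> 1\<close>. This gives existence and
  uniqueness together.\<close>

lemma karcher_mean_eq: "karcher_mean m w A = ut \<delta>\<^sub>1 y\<^sub>G \<delta>\<^sub>2"
  unfolding karcher_mean_def
proof (rule the_equality)
  show "ut \<delta>\<^sub>1 y\<^sub>G \<delta>\<^sub>2 \<in> UT2 \<and> karcher_sum m w A (ut \<delta>\<^sub>1 y\<^sub>G \<delta>\<^sub>2) = 0"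
    using Q_0_ge by (simp add: karcher_sum_ut[where t = 0] y\<^sub>G_def ut_zero)
next
  fix X assume X: "X \<in> UT2 \<and> karcher_sum m w A X = 0"
  obtain x y z where ut: "X = ut x y z" and pos: "x > 0" "z > 0"
    using X UT2_cases by blast
  define t where "t = (ln x - ln \<delta>\<^sub>1) - (ln z - ln \<delta>\<^sub>2)"
  have "ut (ln \<delta>\<^sub>1 - ln x) ((z * P t - y * Q t) / x) (ln \<delta>\<^sub>2 - ln z) = ut 0 0 0"
    using X karcher_sum_ut[OF pos t_def, of y] by (metis ut ut_zero)
  then have eqs: "ln \<delta>\<^sub>1 - ln x = 0" "(z * P t - y * Q t) / x = 0" "ln \<delta>\<^sub>2 - ln z = 0"
    unfolding ut_eq_iff by blast+
  from eqs(1,3) have "x = \<delta>\<^sub>1" "z = \<delta>\<^sub>2"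
    using pos by simp_all
  then have "t = 0" by (simp add: t_def)
  have "y = z * P t / Q t"
    using eqs(2) pos Q_0_ge unfolding \<open>t = 0\<close> by (simp add: nonzero_eq_divide_eq)
  then show "X = ut \<delta>\<^sub>1 y\<^sub>G \<delta>\<^sub>2"
    by (simp add: ut y\<^sub>G_def \<open>x = \<delta>\<^sub>1\<close> \<open>z = \<delta>\<^sub>2\<close> \<open>t = 0\<close>)
qed

lemma diag_part_prod_powr:
  "diag_part (mat_prod_list (map (\<lambda>i. ut_powr (A i) (w i)) [1..<Suc m])) = ut \<delta>\<^sub>1 0 \<delta>\<^sub>2"
proof -
  have "\<exists>b. mat_prod_list (map (\<lambda>i. ut_powr (A i) (w i)) [1..<Suc m]) =
    ut (exp (\<Sum>i\<leftarrow>[1..<Suc m]. w i * ln (A i $ 1 $ 1))) b (exp (\<Sum>i\<leftarrow>[1..<Suc m]. w i * ln (A i $ 2 $ 2)))"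
    by (rule diag_mat_prod_list_powr) (use A_UT2 in auto)
  moreover have "(\<Sum>i\<leftarrow>[1..<Suc m]. f i) = (\<Sum>i=1..m. f i)" for f :: "nat \<Rightarrow> real"
    by (simp only: sum_list_distinct_conv_sum_set distinct_upt set_upt atLeastLessThanSuc_atLeastAtMost)
  ultimately show ?thesis
    by (metis diag_part_ut \<delta>\<^sub>1_def \<delta>\<^sub>2_def)
qed

section \<open>Differentiability of P and Q\<close>

lemma P_has_deriv: "(P has_real_derivative deriv P t) (at t)"
proof -
  have "\<exists>P'. (P has_real_derivative P') (at t)"
    unfolding P_def by (rule exI) (rule derivative_intros)+
  then show ?thesis by (metis DERIV_imp_deriv)
qed

lemma Q_has_deriv: "(Q has_real_derivative deriv Q t) (at t)"
proof -
  have "\<exists>Q'. (Q has_real_derivative Q') (at t)"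
    unfolding Q_def by (rule exI) (rule derivative_intros)+
  then show ?thesis by (metis DERIV_imp_deriv)
qed

lemmas P_deriv [derivative_intros] = DERIV_chain2[OF P_has_deriv]
  and Q_deriv [derivative_intros] = DERIV_chain2[OF Q_has_deriv]

end

subsection \<open>The iteration\<close>

locale karcher_iteration = weighted_UT2 +
  fixes c :: real and X :: "nat \<Rightarrow> real^2^2"
  assumes c_pos: "c > 0" and X_UT2: "\<And>k. X k \<in> UT2"
    and step: "\<And>k. ut_log (matrix_inv (X k) ** X (Suc k)) = (1 / c) *\<^sub>R karcher_sum m w A (X k)"
begin

definition u\<^sub>0 :: real where "u\<^sub>0 = ln (X 0 $ 1 $ 1) - ln \<delta>\<^sub>1"
definition v\<^sub>0 :: real where "v\<^sub>0 = ln (X 0 $ 2 $ 2) - ln \<delta>\<^sub>2"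
definition r :: real where "r = 1 - 1 / c"
definition y :: "nat \<Rightarrow> real" where "y k = X k $ 1 $ 2"

text \<open>\<open>\<kappa> * r ^ k\<close> is the argument t of P and Q at
  \<open>X k\<close>.\<close>

definition \<kappa> :: real where "\<kappa> = u\<^sub>0 - v\<^sub>0"

lemma X_pos: "X k $ 1 $ 1 > 0" "X k $ 2 $ 2 > 0"
  using X_UT2[of k] by (auto simp: UT2_def)

lemma X_eq_ut_entries: "X k = ut (X k $ 1 $ 1) (y k) (X k $ 2 $ 2)"
  unfolding y_def using X_UT2[of k] upper_tri_eq_ut by (auto simp: UT2_def)

lemma step_entries:
  defines "x \<equiv> \<lambda>k. X k $ 1 $ 1" and "z \<equiv> \<lambda>k. X k $ 2 $ 2"
  shows "ln (x (Suc k)) - ln (x k) = (ln \<delta>\<^sub>1 - ln (x k)) / c"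
    and "ln (z (Suc k)) - ln (z k) = (ln \<delta>\<^sub>2 - ln (z k)) / c"
    and "t = (ln (x k) - ln \<delta>\<^sub>1) - (ln (z k) - ln \<delta>\<^sub>2) \<Longrightarrow>
      (y (Suc k) * z k / z (Suc k) - y k) * bern (- t / c) = (z k * P t - y k * Q t) / c"
proof -
  define t where "t = (ln (x k) - ln \<delta>\<^sub>1) - (ln (z k) - ln \<delta>\<^sub>2)"
  have pos: "x k > 0" "z k > 0" "x (Suc k) > 0" "z (Suc k) > 0"
    by (simp_all add: x_def z_def X_pos)
  have eq: "X k = ut (x k) (y k) (z k)" "X (Suc k) = ut (x (Suc k)) (y (Suc k)) (z (Suc k))"
    unfolding x_def z_def by (rule X_eq_ut_entries)+
  have "ut (ln (x (Suc k) / x k))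
      ((y (Suc k) / x k - y k * z (Suc k) / (x k * z k)) * log_quot (x (Suc k) / x k) (z (Suc k) / z k))
      (ln (z (Suc k) / z k)) =
    ut ((1 / c) * (ln \<delta>\<^sub>1 - ln (x k))) ((1 / c) * ((z k * P t - y k * Q t) / x k)) ((1 / c) * (ln \<delta>\<^sub>2 - ln (z k)))"
    using step[of k] unfolding eq karcher_sum_ut[OF pos(1,2) t_def] ut_scaleR
      matrix_inv_ut_mult[OF pos(1,2)] using pos by (subst (asm) ut_log_ut) simp_all
  then have x: "ln (x (Suc k) / x k) = (ln \<delta>\<^sub>1 - ln (x k)) / c"
    and z: "ln (z (Suc k) / z k) = (ln \<delta>\<^sub>2 - ln (z k)) / c"
    and y: "(y (Suc k) / x k - y k * z (Suc k) / (x k * z k)) * log_quot (x (Suc k) / x k) (z (Suc k) / z k) =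
      (1 / c) * ((z k * P t - y k * Q t) / x k)"
    unfolding ut_eq_iff by auto
  show "ln (x (Suc k)) - ln (x k) = (ln \<delta>\<^sub>1 - ln (x k)) / c"
    "ln (z (Suc k)) - ln (z k) = (ln \<delta>\<^sub>2 - ln (z k)) / c"
    using x z pos by (simp_all add: ln_div)
  \<comment> \<open>Each logarithmic diagonal error moves by \<open>- 1 / c\<close> times itself, so
    the logarithm of the step matrix brings in \<open>bern\<close> at
    \<open>- t / c\<close>.\<close>
  have "ln (x (Suc k) / x k) - ln (z (Suc k) / z k) = - t / c"
    unfolding x z t_def by (simp add: diff_divide_distrib)
  then have "log_quot (x (Suc k) / x k) (z (Suc k) / z k) = bern (- t / c) / (z (Suc k) / z k)"
    using pos by (simp add: log_quot_eq_bern)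
  with y have "x k * ((y (Suc k) / x k - y k * z (Suc k) / (x k * z k)) * (bern (- t / c) / (z (Suc k) / z k))) =
      x k * ((1 / c) * ((z k * P t - y k * Q t) / x k))"
    by simp
  moreover have "x k * ((y (Suc k) / x k - y k * z (Suc k) / (x k * z k)) * (bern (- t / c) / (z (Suc k) / z k))) =
    (y (Suc k) * z k / z (Suc k) - y k) * bern (- t / c)"
    using pos by (simp add: field_simps)
  ultimately show "(y (Suc k) * z k / z (Suc k) - y k) * bern (- t / c) = (z k * P t - y k * Q t) / c"
    if "t = (ln (x k) - ln \<delta>\<^sub>1) - (ln (z k) - ln \<delta>\<^sub>2)" for t
    using pos that by (simp add: t_def)
qed

lemma ln_diag:
  "ln (X k $ 1 $ 1) = ln \<delta>\<^sub>1 + r ^ k * u\<^sub>0" "ln (X k $ 2 $ 2) = ln \<delta>\<^sub>2 + r ^ k * v\<^sub>0"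
proof (induction k)
  case (Suc k)
  case 1
  show ?case using step_entries(1)[of k] Suc by (simp add: r_def algebra_simps diff_divide_distrib add_divide_distrib)
  case 2
  show ?case using step_entries(2)[of k] Suc by (simp add: r_def algebra_simps diff_divide_distrib add_divide_distrib)
qed (simp_all add: u\<^sub>0_def v\<^sub>0_def)

lemma X_eq_ut: "X k = ut (\<delta>\<^sub>1 * exp (r ^ k * u\<^sub>0)) (y k) (\<delta>\<^sub>2 * exp (r ^ k * v\<^sub>0))"
proof -
  have exp_eq: "s = \<delta> * exp t" if "ln s = ln \<delta> + t" "s > 0" "\<delta> > 0" for s \<delta> t :: real
    using that by (metis exp_add exp_ln)
  have entries: "X k $ 1 $ 1 = \<delta>\<^sub>1 * exp (r ^ k * u\<^sub>0)" "X k $ 2 $ 2 = \<delta>\<^sub>2 * exp (r ^ k * v\<^sub>0)"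
    by (rule exp_eq; simp add: ln_diag X_pos)+
  show ?thesis
    using X_eq_ut_entries[of k] unfolding entries .
qed

lemma karcher_sum_X:
  "karcher_sum m w A (X k) = ut (- (r ^ k * u\<^sub>0))
    ((\<delta>\<^sub>2 * exp (r ^ k * v\<^sub>0) * P (\<kappa> * r ^ k) - y k * Q (\<kappa> * r ^ k)) / (\<delta>\<^sub>1 * exp (r ^ k * u\<^sub>0)))
    (- (r ^ k * v\<^sub>0))"
proof -
  have "\<kappa> * r ^ k = (ln (\<delta>\<^sub>1 * exp (r ^ k * u\<^sub>0)) - ln \<delta>\<^sub>1) - (ln (\<delta>\<^sub>2 * exp (r ^ k * v\<^sub>0)) - ln \<delta>\<^sub>2)"
    by (simp add: ln_mult \<kappa>_def algebra_simps)
  from karcher_sum_ut[OF _ _ this, of "y k"] show ?thesis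
    by (subst X_eq_ut) (simp add: ln_mult)
qed

text \<open>The argument \<open>h\<close> stands for \<open>r ^ k\<close>; \<open>contraction\<close> and \<open>perturbation\<close> are the \<open>\<Phi>\<close> and \<open>\<Psi>\<close> of the introduction.\<close>

definition residual :: "real \<Rightarrow> real" where
  "residual h = \<delta>\<^sub>2 * exp (h * v\<^sub>0) * P (\<kappa> * h) - y\<^sub>G * Q (\<kappa> * h)"
definition contraction :: "real \<Rightarrow> real" where
  "contraction h = exp ((r - 1) * v\<^sub>0 * h) * (1 - Q (\<kappa> * h) / (c * bern (- \<kappa> * h / c)))"
definition perturbation :: "real \<Rightarrow> real" where
  "perturbation h = exp ((r - 1) * v\<^sub>0 * h) * (y\<^sub>G + residual h / (c * bern (- \<kappa> * h / c))) - y\<^sub>G"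

text \<open>\<open>residual\<close> is the numerator of the corner of the Karcher sum when the
  corner of X is already \<open>y\<^sub>G\<close>; at h = 0 it vanishes by the choice of
  \<open>y\<^sub>G\<close>.\<close>

lemma residual_0: "residual 0 = 0"
  using Q_0_ge by (simp add: residual_def y\<^sub>G_def)

lemma perturbation_0: "perturbation 0 = 0"
  by (simp add: perturbation_def residual_0)

lemma contraction_0: "contraction 0 = 1 - Q 0 / c"
  by (simp add: contraction_def)

lemma off_diagonal_recursion:
  "y (Suc k) - y\<^sub>G = contraction (r ^ k) * (y k - y\<^sub>G) + perturbation (r ^ k)"
proof -
  define h where "h = r ^ k"
  define B where "B = bern (- (\<kappa> * h) / c)"
  have B: "B > 0" by (simp add: B_def bern_pos)
  \<comment> \<open>E is the ratio of the lower diagonal entries of \<open>X (Suc k)\<close> and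
    \<open>X k\<close>.\<close>
  define E where "E = exp ((r - 1) * v\<^sub>0 * h)"
  have z: "X k $ 2 $ 2 = \<delta>\<^sub>2 * exp (h * v\<^sub>0)" "X (Suc k) $ 2 $ 2 = \<delta>\<^sub>2 * exp (r * h * v\<^sub>0)"
    by (subst X_eq_ut, simp add: h_def)+
  have "E = exp (r * h * v\<^sub>0) / exp (h * v\<^sub>0)"
    by (simp add: E_def algebra_simps flip: exp_diff)
  then have ratio: "X k $ 2 $ 2 / X (Suc k) $ 2 $ 2 = 1 / E"
    by (simp add: z)
  define p where "p = \<delta>\<^sub>2 * exp (h * v\<^sub>0) * P (\<kappa> * h)"
  define q where "q = Q (\<kappa> * h)"
  have "\<kappa> * h = (ln (X k $ 1 $ 1) - ln \<delta>\<^sub>1) - (ln (X k $ 2 $ 2) - ln \<delta>\<^sub>2)"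
    unfolding ln_diag by (simp add: \<kappa>_def h_def algebra_simps)
  from step_entries(3)[OF this]
  have "(y (Suc k) * (X k $ 2 $ 2 / X (Suc k) $ 2 $ 2) - y k) * B = (p - y k * q) / c"
    unfolding B_def p_def q_def z(1)[symmetric] by simp
  then have "y (Suc k) / E - y k = (p - y k * q) / (c * B)"
    using B c_pos unfolding ratio by (simp add: field_simps)
  moreover have "E > 0"
    by (simp add: E_def)
  ultimately have "y (Suc k) = E * (y k + (p - y k * q) / (c * B))"
    by (simp add: diff_eq_eq divide_eq_eq mult.commute add.commute)
  \<comment> \<open>Writing \<open>y k = (y k - y\<^sub>G) + y\<^sub>G\<close> in the affine update
    separates the multiplier of the error from the forcing term.\<close>
  then have "y (Suc k) - y\<^sub>G = E * (1 - q / (c * B)) * (y k - y\<^sub>G) +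
      (E * (y\<^sub>G + (p - y\<^sub>G * q) / (c * B)) - y\<^sub>G)"
    by (simp add: diff_divide_distrib algebra_simps)
  then show ?thesis
    by (simp add: contraction_def perturbation_def residual_def E_def B_def p_def q_def h_def)
qed

lemma bern_nonzero: "bern t \<noteq> 0"
  using bern_pos[of t] by simp

lemma residual_has_deriv: "\<exists>D. (residual has_real_derivative D) (at h)"
  unfolding residual_def by (rule exI) (rule derivative_intros)+

lemma contraction_has_deriv: "\<exists>D. (contraction has_real_derivative D) (at h)"
  unfolding contraction_def
  by (rule exI) (rule derivative_intros | use c_pos bern_nonzero in simp)+

lemma perturbation_has_deriv: "\<exists>D. (perturbation has_real_derivative D) (at h)"
proof -
  obtain R where "(residual has_real_derivative R) (at h)"
    using residual_has_deriv by blast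
  then show ?thesis
    unfolding perturbation_def
    by (intro exI) (rule derivative_intros | assumption | use c_pos bern_nonzero in simp)+
qed

section \<open>Convergence and decay for c > 1/2\<close>

lemma abs_r_less_1_iff: "\<bar>r\<bar> < 1 \<longleftrightarrow> c > 1 / 2"
  using c_pos by (auto simp: r_def abs_less_iff field_simps)

lemma power_r_tendsto_0: "c > 1 / 2 \<Longrightarrow> (\<lambda>k. r ^ k) \<longlonglongrightarrow> 0"
  using abs_r_less_1_iff by (intro LIMSEQ_abs_realpow_zero2) auto

lemma diag_part_X_tendsto:
  assumes "c > 1 / 2"
  shows "(\<lambda>k. diag_part (X k)) \<longlonglongrightarrow> ut \<delta>\<^sub>1 0 \<delta>\<^sub>2"
proof -
  have "(\<lambda>k. ut (\<delta>\<^sub>1 * exp (r ^ k * u\<^sub>0)) 0 (\<delta>\<^sub>2 * exp (r ^ k * v\<^sub>0))) \<longlonglongrightarrow>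
      ut (\<delta>\<^sub>1 * exp (0 * u\<^sub>0)) 0 (\<delta>\<^sub>2 * exp (0 * v\<^sub>0))"
    by (intro ut_tendsto tendsto_mult tendsto_exp tendsto_const power_r_tendsto_0 assms)
  moreover have "diag_part (X k) = ut (\<delta>\<^sub>1 * exp (r ^ k * u\<^sub>0)) 0 (\<delta>\<^sub>2 * exp (r ^ k * v\<^sub>0))" for k
    by (subst X_eq_ut) (rule diag_part_ut)
  ultimately show ?thesis by simp
qed

lemma off_diagonal_error_bigo:
  assumes c: "c > 1 / 2" and \<rho>: "\<bar>r\<bar> < \<rho>" "\<bar>1 - Q 0 / c\<bar> < \<rho>"
  shows "(\<lambda>k. y k - y\<^sub>G) \<in> O(\<lambda>k. \<rho> ^ k)"
proof (rule perturbed_linear_recursion_bigo)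
  have "isCont contraction 0"
    using contraction_has_deriv DERIV_isCont by blast
  then show "(\<lambda>k. contraction (r ^ k)) \<longlonglongrightarrow> 1 - Q 0 / c"
    using power_r_tendsto_0[OF c] by (metis contraction_0 isCont_tendsto_compose)
  show "(\<lambda>k. perturbation (r ^ k)) \<in> O(\<lambda>k. \<rho> ^ k)"
    using perturbation_has_deriv[of 0] c \<rho>(1)
    by (auto simp: abs_r_less_1_iff perturbation_0 intro: differentiable_at_power_bigo)
qed (use \<rho>(2) off_diagonal_recursion in auto)

lemma X_error_bigo:
  assumes c: "c > 1 / 2" and \<rho>: "\<bar>r\<bar> < \<rho>" "\<bar>1 - Q 0 / c\<bar> < \<rho>"
  shows "(\<lambda>k. (X k - karcher_mean m w A) $ i $ j) \<in> O(\<lambda>k. \<rho> ^ k)"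
proof -
  \<comment> \<open>The diagonal errors are differentiable functions of \<open>r ^ k\<close> that
    vanish at 0.\<close>
  have "(\<lambda>k. \<delta> * exp (r ^ k * u) - \<delta>) \<in> O(\<lambda>k. \<rho> ^ k)" for \<delta> u
    using c \<rho>
    by (intro differentiable_at_power_bigo[where f = "\<lambda>h. \<delta> * exp (h * u) - \<delta>" and f' = "\<delta> * u"])
       (auto simp: abs_r_less_1_iff intro!: derivative_eq_intros)
  then show ?thesis
    using off_diagonal_error_bigo[OF assms] exhaust_2[of i] exhaust_2[of j]
    by (subst X_eq_ut) (auto simp: karcher_mean_eq)
qed

text \<open>The numerator of the corner is \<open>residual (r ^ k)\<close> minus the off-diagonal
  error times a bounded factor, and the reciprocal of the denominator is bounded as well.\<close>

lemma karcher_sum_X_bigo: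
  assumes c: "c > 1 / 2" and \<rho>: "\<bar>r\<bar> < \<rho>" "\<bar>1 - Q 0 / c\<bar> < \<rho>"
  shows "(\<lambda>k. karcher_sum m w A (X k) $ i $ j) \<in> O(\<lambda>k. \<rho> ^ k)"
proof -
  have r: "\<bar>r\<bar> < 1" "\<bar>r\<bar> \<le> \<rho>" using c \<rho> by (auto simp: abs_r_less_1_iff)
  have diag: "(\<lambda>k. - (r ^ k * u)) \<in> O(\<lambda>k. \<rho> ^ k)" for u
    using r by (intro differentiable_at_power_bigo[where f = "\<lambda>h. - (h * u)" and f' = "- u"])
      (auto intro!: derivative_eq_intros)
  have cont_Q: "isCont Q t" for t
    using Q_has_deriv DERIV_isCont by blast
  have "(\<lambda>k. Q (\<kappa> * r ^ k)) \<longlonglongrightarrow> Q (\<kappa> * 0)"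
    by (intro isCont_tendsto_compose[OF cont_Q] tendsto_mult tendsto_divide tendsto_exp tendsto_const power_r_tendsto_0 c)
  then have "(\<lambda>k. Q (\<kappa> * r ^ k)) \<in> O(\<lambda>_. 1)"
    by (intro bigoI_tendsto[where c = "Q (\<kappa> * 0)"]) auto
  from landau_o.big.mult[OF off_diagonal_error_bigo[OF assms] this]
  have "(\<lambda>k. (y k - y\<^sub>G) * Q (\<kappa> * r ^ k)) \<in> O(\<lambda>k. \<rho> ^ k)"
    by simp
  moreover have "(\<lambda>k. residual (r ^ k)) \<in> O(\<lambda>k. \<rho> ^ k)"
    using residual_has_deriv[of 0] r by (auto simp: residual_0 intro: differentiable_at_power_bigo)
  ultimately have num: "(\<lambda>k. residual (r ^ k) - (y k - y\<^sub>G) * Q (\<kappa> * r ^ k)) \<in> O(\<lambda>k. \<rho> ^ k)"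
    by (intro sum_in_bigo)
  have "(\<lambda>k. 1 / (\<delta>\<^sub>1 * exp (r ^ k * u\<^sub>0))) \<longlonglongrightarrow> 1 / (\<delta>\<^sub>1 * exp (0 * u\<^sub>0))"
    by (intro tendsto_mult tendsto_divide tendsto_exp tendsto_const power_r_tendsto_0 c) simp
  then have "(\<lambda>k. 1 / (\<delta>\<^sub>1 * exp (r ^ k * u\<^sub>0))) \<in> O(\<lambda>_. 1)"
    by (intro bigoI_tendsto[where c = "1 / (\<delta>\<^sub>1 * exp (0 * u\<^sub>0))"]) auto
  from landau_o.big.mult[OF num this]
  have "(\<lambda>k. (residual (r ^ k) - (y k - y\<^sub>G) * Q (\<kappa> * r ^ k)) / (\<delta>\<^sub>1 * exp (r ^ k * u\<^sub>0))) \<in> O(\<lambda>k. \<rho> ^ k)"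
    by simp
  also have "(\<lambda>k. (residual (r ^ k) - (y k - y\<^sub>G) * Q (\<kappa> * r ^ k)) / (\<delta>\<^sub>1 * exp (r ^ k * u\<^sub>0))) =
    (\<lambda>k. (\<delta>\<^sub>2 * exp (r ^ k * v\<^sub>0) * P (\<kappa> * r ^ k) - y k * Q (\<kappa> * r ^ k)) / (\<delta>\<^sub>1 * exp (r ^ k * u\<^sub>0)))"
    by (simp add: residual_def left_diff_distrib)
  finally show ?thesis
    using diag exhaust_2[of i] exhaust_2[of j] unfolding karcher_sum_X by auto
qed

section \<open>Divergence for c at most 1/2\<close>

lemma convergent_imp_X_0_eq_karcher_mean:
  assumes c: "c \<le> 1 / 2" and conv: "convergent X"
  shows "X 0 = karcher_mean m w A"
proof -
  have r: "r \<le> - 1" using c c_pos by (simp add: r_def field_simps)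
  obtain L where L: "X \<longlonglongrightarrow> L" using conv by (auto simp: convergent_def)
  have entry: "(\<lambda>k. X k $ i $ j) \<longlonglongrightarrow> L $ i $ j" for i j
    by (intro tendsto_vec_nth L)
  have "(\<lambda>k. X k $ 1 $ 1 / \<delta>\<^sub>1) \<longlonglongrightarrow> L $ 1 $ 1 / \<delta>\<^sub>1" "(\<lambda>k. X k $ 2 $ 2 / \<delta>\<^sub>2) \<longlonglongrightarrow> L $ 2 $ 2 / \<delta>\<^sub>2"
    by (intro tendsto_intros entry, simp)+
  moreover have "X k $ 1 $ 1 / \<delta>\<^sub>1 = exp (r ^ k * u\<^sub>0)" "X k $ 2 $ 2 / \<delta>\<^sub>2 = exp (r ^ k * v\<^sub>0)" for k
    by (subst X_eq_ut, simp)+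
  ultimately have "convergent (\<lambda>k. exp (r ^ k * u\<^sub>0))" "convergent (\<lambda>k. exp (r ^ k * v\<^sub>0))"
    by (auto simp: convergent_def)
  then have u: "u\<^sub>0 = 0" and v: "v\<^sub>0 = 0"
    using r exp_power_not_convergent by blast+
  \<comment> \<open>Now \<kappa> = 0, so P and Q are evaluated at 0 throughout and the residual is 0
    by the choice of \<open>y\<^sub>G\<close>.\<close>
  have "y (Suc k) - y\<^sub>G = (1 - Q 0 / c) * (y k - y\<^sub>G)" for k
    unfolding off_diagonal_recursion using Q_0_ge
    by (simp add: contraction_def perturbation_def residual_def \<kappa>_def u v y\<^sub>G_def)
  moreover have "1 - Q 0 / c \<le> - 1"
    using c c_pos Q_0_ge by (simp add: field_simps)
  moreover have "convergent (\<lambda>k. y k - y\<^sub>G)"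
    unfolding y_def by (rule convergentI[OF tendsto_diff[OF entry tendsto_const]])
  ultimately have "y 0 - y\<^sub>G = 0"
    by (rule linear_recursion_not_convergent)
  then show ?thesis
    by (subst X_eq_ut) (simp add: u v karcher_mean_eq)
qed

end

theorem theorem2p7:
  fixes m :: nat and w :: "nat \<Rightarrow> real" and A :: "nat \<Rightarrow> real^2^2"
    and X\<^sub>0 D G :: "real^2^2" and c c\<^sub>0 :: real
    and X S :: "nat \<Rightarrow> real^2^2"
  assumes "m \<ge> 1"
    and "\<forall>i\<in>{1..m}. w i \<ge> 0" and "(\<Sum>i=1..m. w i) = 1"
    and "\<forall>i\<in>{1..m}. A i \<in> UT2" and "X\<^sub>0 \<in> UT2" and "c > 0"
    and "D = diag_part (mat_prod_list (map (\<lambda>i. ut_powr (A i) (w i)) [1..<Suc m]))"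
    and "c\<^sub>0 = (\<Sum>i=1..m. w i *
           log_quot ((matrix_inv D ** A i) $ 2 $ 2 / (matrix_inv D ** A i) $ 1 $ 1) 1)"
    and "G = karcher_mean m w A"
    and "X 0 = X\<^sub>0" and "\<forall>k. X k \<in> UT2"
    and "\<forall>k. S k = ut_log (matrix_inv (X k) ** X (Suc k))"
    and "\<forall>k. S k = (1 / c) *\<^sub>R (\<Sum>i=1..m. w i *\<^sub>R ut_log (matrix_inv (X k) ** A i))"
  shows "(c > 1/2 \<longrightarrow>
            (\<lambda>k. diag_part (X k)) \<longlonglongrightarrow> D \<and>
            (\<forall>i. geometric_seq (\<lambda>k. S k $ i $ i) (1 - 1 / c))) \<and>
         (c > c\<^sub>0 / 2 \<longrightarrow>
            X \<longlonglongrightarrow> G \<and> S \<longlonglongrightarrow> 0 \<and>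
            asymp_rate (\<lambda>k. X k - G) 0 \<le> ereal (max \<bar>1 - 1 / c\<bar> \<bar>1 - c\<^sub>0 / c\<bar>) \<and>
            asymp_rate S 0 \<le> ereal (max \<bar>1 - 1 / c\<bar> \<bar>1 - c\<^sub>0 / c\<bar>)) \<and>
         (c \<le> 1/2 \<and> X\<^sub>0 \<noteq> G \<longrightarrow> \<not> convergent X)"
proof -
  have S: "S k = (1 / c) *\<^sub>R karcher_sum m w A (X k)" for k
    using assms(13) by (simp add: karcher_sum_def)
  interpret karcher_iteration m w A c X
  proof unfold_locales
    show "ut_log (matrix_inv (X k) ** X (Suc k)) = (1 / c) *\<^sub>R karcher_sum m w A (X k)" for k
      by (rule trans[OF assms(12)[rule_format, symmetric] S])
  qed (use assms(2-4,6,11) in blast)+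
  have D: "D = ut \<delta>\<^sub>1 0 \<delta>\<^sub>2"
    using assms(7) diag_part_prod_powr by simp
  have "matrix_inv D ** A i = ut (A i $ 1 $ 1 / \<delta>\<^sub>1) (A i $ 1 $ 2 / \<delta>\<^sub>1) (A i $ 2 $ 2 / \<delta>\<^sub>2)"
    if "i \<in> {1..m}" for i
    unfolding D by (subst A_eq_ut[OF that], subst matrix_inv_ut_mult) simp_all
  then have c\<^sub>0: "c\<^sub>0 = Q 0"
    unfolding assms(8) Q_0_eq_log_quot by (intro sum.cong) auto
  define \<rho> where "\<rho> = max \<bar>1 - 1 / c\<bar> \<bar>1 - c\<^sub>0 / c\<bar>"
  \<comment> \<open>The diagonal entries of \<open>S k\<close> are
    \<open>- (r ^ k * u\<^sub>0) / c\<close> and \<open>- (r ^ k * v\<^sub>0) / c\<close>.\<close>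
  have geometric: "geometric_seq (\<lambda>k. S k $ i $ i) (1 - 1 / c)" for i
    using exhaust_2[of i] unfolding geometric_seq_def S karcher_sum_X by (auto simp: r_def)
  have bigo: "(\<lambda>k. (X k - G) $ i $ j) \<in> O(\<lambda>k. \<rho>' ^ k)" "(\<lambda>k. S k $ i $ j) \<in> O(\<lambda>k. \<rho>' ^ k)"
    if "c > c\<^sub>0 / 2" "\<rho> < \<rho>'" for \<rho>' i j
  proof -
    have c: "c > 1 / 2" using that Q_0_ge c\<^sub>0 by simp
    have "\<bar>r\<bar> < \<rho>'" "\<bar>1 - Q 0 / c\<bar> < \<rho>'"
      using that by (simp_all add: \<rho>_def r_def c\<^sub>0)
    note X_error_bigo[OF c this, of i j] karcher_sum_X_bigo[OF c this, of i j]
    then show "(\<lambda>k. (X k - G) $ i $ j) \<in> O(\<lambda>k. \<rho>' ^ k)" "(\<lambda>k. S k $ i $ j) \<in> O(\<lambda>k. \<rho>' ^ k)"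
      using \<open>c > 0\<close> by (simp_all add: S assms(9) landau_o.big.cdiv_in_iff')
  qed
  have part2: "X \<longlonglongrightarrow> G \<and> S \<longlonglongrightarrow> 0 \<and>
      asymp_rate (\<lambda>k. X k - G) 0 \<le> ereal \<rho> \<and> asymp_rate S 0 \<le> ereal \<rho>"
    if c: "c > c\<^sub>0 / 2"
  proof -
    have "\<rho> < 1"
      using c Q_0_ge \<open>c > 0\<close> by (auto simp: \<rho>_def c\<^sub>0 abs_less_iff field_simps)
    \<comment> \<open>The decay bounds hold only strictly above \<rho>, so convergence uses one rate
      between \<rho> and 1; the rate estimates below use all of them.\<close>
    then obtain \<rho>' where \<rho>': "\<rho> < \<rho>'" "\<rho>' < 1" using dense by blast
    have "\<rho> \<ge> 0" by (simp add: \<rho>_def)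
    with \<rho>' have "\<bar>\<rho>'\<bar> < 1" by simp
    then have "(\<lambda>k. X k - G) \<longlonglongrightarrow> 0" "S \<longlonglongrightarrow> 0"
      by (rule matrix_bigo_power_tendsto_0[OF bigo(1)[OF c \<rho>'(1)]],
          rule matrix_bigo_power_tendsto_0[OF bigo(2)[OF c \<rho>'(1)]])
    moreover have "asymp_rate (\<lambda>k. X k - G) 0 \<le> ereal \<rho>" "asymp_rate S 0 \<le> ereal \<rho>"
      using bigo[OF c] \<open>\<rho> \<ge> 0\<close> by (intro asymp_rate_le; simp)+
    ultimately show ?thesis
      using LIM_zero_cancel by blast
  qed
  show ?thesis
    using diag_part_X_tendsto geometric part2 convergent_imp_X_0_eq_karcher_mean
    unfolding D \<rho>_def assms(9) assms(10)[symmetric] by blast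
qed

end
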